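(* The coarse groups $(\mathbb Z, d_2)$ and $(\mathbb Z, d_3)$ are not coarsely isomorphic.
   Context: $\mathbb N$ includes $0$. For an integer $g \geq 2$ let $S_g = \{\pm g^n : n \in \mathbb N\}$. The word length $\ell_g(n)$ of $n \in \mathbb Z$ is the minimal number of elements of $S_g$ (counted with multiplicity) adding up to $n$ (so $\ell_g(0)=0$), and $d_g(n,m) = \ell_g(n-m)$ is the induced metric on $\mathbb Z$ (the path metric of the Cayley graph of $\mathbb Z$ with respect to $S_g$; the paper denotes the resulting coarse structure by $\mathcal E_{\mathrm{Cay}(S_g)}$). $(\mathbb Z,d_g)$ is regarded as a coarse group under addition. For metric spaces $(X,d_X)$, $(Y,d_Y)$: a function $f\colon X \to Y$ is controlled if for every $R \geq 0$ there is $S \geq 0$ such that $d_X(x,x') \leq R$ implies $d_Y(f(x),f(x')) \leq S$. Two functions $f,f'\colon X\to Y$ are close if $\sup_{x \in X} d_Y(f(x),f'(x)) < \infty$. A controlled function $f\colon X\to Y$ is a coarse equivalence if there is a controlled function $h\colon Y \to X$ such that $h\circ f$ is close to $\mathrm{id}_X$ and $f \circ h$ is close to $\mathrm{id}_Y$. $(\mathbb Z, d_{g_1})$ and $(\mathbb Z, d_{g_2})$ are coarsely isomorphic (isomorphic as coarse groups) if there exists a coarse equivalence $f\colon (\mathbb Z,d_{g_1}) \to (\mathbb Z,d_{g_2})$ for which there is a constant $C \geq 0$ with $d_{g_2}\bigl(f(a+b), f(a)+f(b)\bigr) \leq C$ for all $a,b \in \mathbb Z$. *)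

theory Defs
  imports "HOL-Analysis.Analysis"
begin

definition gens :: "int \<Rightarrow> int set" where
  "gens g = {s. \<exists>n::nat. s = g ^ n \<or> s = - (g ^ n)}"

definition word_length :: "int \<Rightarrow> int \<Rightarrow> nat" where
  "word_length g n = (LEAST k. \<exists>xs. length xs = k \<and> set xs \<subseteq> gens g \<and> sum_list xs = n)"

definition word_dist :: "int \<Rightarrow> int \<Rightarrow> int \<Rightarrow> real" where
  "word_dist g n m = real (word_length g (n - m))"

text \<open>Metrics are passed as explicit distance functions on a whole type, since the two metrics
  to be compared live on the same type \<^typ>\<open>int\<close>.\<close>

definition controlled :: "('a \<Rightarrow> 'a \<Rightarrow> real) \<Rightarrow> ('b \<Rightarrow> 'b \<Rightarrow> real) \<Rightarrow> ('a \<Rightarrow> 'b) \<Rightarrow> bool" where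
  "controlled dX dY f \<longleftrightarrow>
     (\<forall>R\<ge>0. \<exists>S\<ge>0. \<forall>x x'. dX x x' \<le> R \<longrightarrow> dY (f x) (f x') \<le> S)"

definition close_functions :: "('b \<Rightarrow> 'b \<Rightarrow> real) \<Rightarrow> ('a \<Rightarrow> 'b) \<Rightarrow> ('a \<Rightarrow> 'b) \<Rightarrow> bool" where
  "close_functions dY f f' \<longleftrightarrow> bdd_above (range (\<lambda>x. dY (f x) (f' x)))"

definition coarse_equivalence ::
    "('a \<Rightarrow> 'a \<Rightarrow> real) \<Rightarrow> ('b \<Rightarrow> 'b \<Rightarrow> real) \<Rightarrow> ('a \<Rightarrow> 'b) \<Rightarrow> bool" where
  "coarse_equivalence dX dY f \<longleftrightarrow>
     controlled dX dY f \<and>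
     (\<exists>h. controlled dY dX h \<and> close_functions dX (h \<circ> f) id \<and> close_functions dY (f \<circ> h) id)"

definition coarsely_isomorphic ::
    "('a::group_add \<Rightarrow> 'a \<Rightarrow> real) \<Rightarrow> ('b::group_add \<Rightarrow> 'b \<Rightarrow> real) \<Rightarrow> bool" where
  "coarsely_isomorphic dX dY \<longleftrightarrow>
     (\<exists>f. coarse_equivalence dX dY f \<and> (\<exists>C\<ge>0. \<forall>a b. dY (f (a + b)) (f a + f b) \<le> C))"

text \<open>The minimum defining \<^const>\<open>word_length\<close> is over a nonempty set (so the \<open>LEAST\<close> is not
  degenerate), and \<^const>\<open>word_dist\<close> is a translation-invariant metric.\<close>

lemma uminus_gens: "s \<in> gens g \<Longrightarrow> - s \<in> gens g"
  by (auto simp: gens_def)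

lemma word_exists: "\<exists>xs. set xs \<subseteq> gens g \<and> sum_list xs = n"
proof -
  have "1 \<in> gens g" "-1 \<in> gens g"
    unfolding gens_def by (auto intro: exI[of _ "0::nat"])
  then show ?thesis
    by (intro exI[of _ "replicate (nat \<bar>n\<bar>) (if n \<ge> 0 then 1 else -1)"])
       (auto simp: sum_list_replicate)
qed

lemma word_length_attained:
  obtains xs where "length xs = word_length g n" "set xs \<subseteq> gens g" "sum_list xs = n"
proof -
  have "\<exists>xs. length xs = word_length g n \<and> set xs \<subseteq> gens g \<and> sum_list xs = n"
    unfolding word_length_def by (rule LeastI_ex) (use word_exists in blast)
  with that show ?thesis by blast
qed

lemma word_length_le:
  assumes "set xs \<subseteq> gens g"
  shows "word_length g (sum_list xs) \<le> length xs"
  unfolding word_length_def by (rule Least_le) (use assms in blast)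

lemma word_length_0 [simp]: "word_length g 0 = 0"
  using word_length_le[of "[]" g] by simp

lemma word_length_eq_0_iff [simp]: "word_length g n = 0 \<longleftrightarrow> n = 0"
proof
  assume "word_length g n = 0"
  then show "n = 0"
    using word_length_attained[of g n] by force
qed simp

lemma word_length_triangle: "word_length g (m + n) \<le> word_length g m + word_length g n"
proof -
  obtain xs ys
    where "length xs = word_length g m" "set xs \<subseteq> gens g" "sum_list xs = m"
      and "length ys = word_length g n" "set ys \<subseteq> gens g" "sum_list ys = n"
    using word_length_attained[of g m] word_length_attained[of g n] by metis
  then show ?thesis
    using word_length_le[of "xs @ ys" g] by simp
qed

lemma word_length_uminus_le: "word_length g (- n) \<le> word_length g n"
proof -
  obtain xs where xs: "length xs = word_length g n" "set xs \<subseteq> gens g" "sum_list xs = n"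
    by (rule word_length_attained)
  have "sum_list (map uminus xs) = - sum_list xs"
    by (induction xs) auto
  then show ?thesis
    using word_length_le[of "map uminus xs" g] xs uminus_gens by (auto simp: subset_iff)
qed

lemma word_length_uminus [simp]: "word_length g (- n) = word_length g n"
  using word_length_uminus_le[of g n] word_length_uminus_le[of g "- n"] by simp

lemma Metric_space_word_dist: "Metric_space UNIV (word_dist g)"
proof
  show "word_dist g x y = word_dist g y x" for x y
    using word_length_uminus[of g "x - y"] by (simp add: word_dist_def)
  show "word_dist g x z \<le> word_dist g x y + word_dist g y z" for x y z
    using word_length_triangle[of g "x - y" "y - z"] by (simp add: word_dist_def)
qed (auto simp: word_dist_def)

lemma word_dist_translate: "word_dist g (a + n) (a + m) = word_dist g n m"
  by (simp add: word_dist_def)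

end

theory Submission
  imports Defs
begin

text \<open>Multiplication by \<open>2 ^ k\<close> does not increase \<open>\<ell>\<^sub>2\<close>. Transporting this along a coarse isomorphism
  gives \<open>\<ell>\<^sub>3 (2 ^ k * y) \<le> A * \<ell>\<^sub>3 y + B\<close> where \<open>A\<close> depends neither on \<open>k\<close> nor on \<open>y\<close>, and only \<open>B\<close>
  depends on \<open>k\<close>. The number of nonzero balanced ternary digits is a lower bound for \<open>\<ell>\<^sub>3\<close>.
  Since \<open>2 ^ (3 ^ n) \<equiv> -1\<close> modulo \<open>3 ^ (n + 1)\<close>, the power \<open>2 ^ (3 ^ n - 1)\<close> is congruent to
  \<open>(3 ^ (n + 1) - 1) / 2 = 1 + 3 + \<dots> + 3 ^ n\<close>, so it has more than \<open>n\<close> nonzero digits. Taking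
  for \<open>y\<close> a sum of \<open>N\<close> widely spaced powers of \<open>3\<close> makes \<open>\<ell>\<^sub>3 (2 ^ k * y)\<close> at least \<open>(n + 1) * N\<close>
  while \<open>\<ell>\<^sub>3 y \<le> N\<close>, which is a contradiction for \<open>n \<ge> A\<close> and \<open>N\<close> large.\<close>

section \<open>Word length under multiplication\<close>

lemma word_length_gen_le: "s \<in> gens g \<Longrightarrow> word_length g s \<le> 1"
  using word_length_le[of "[s]" g] by simp

text \<open>\<open>gens g\<close> is closed under multiplication by \<open>g ^ k\<close>, so a
  shortest word for \<open>x\<close> can be scaled letter by letter.\<close>

lemma word_length_power_mult_le: "word_length g (g ^ k * x) \<le> word_length g x"
proof -
  obtain xs where xs: "length xs = word_length g x" "set xs \<subseteq> gens g" "sum_list xs = x"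
    by (rule word_length_attained)
  have "g ^ k * s \<in> gens g" if "s \<in> gens g" for s
    using that unfolding gens_def by (auto simp flip: power_add)
  then have "set (map (\<lambda>s. g ^ k * s) xs) \<subseteq> gens g"
    using xs(2) by auto
  from word_length_le[OF this] show ?thesis
    using xs by (simp add: sum_list_const_mult)
qed

lemma word_length_of_nat_mult_le: "word_length g (int m * x) \<le> m * word_length g x"
proof (induction m)
  case (Suc m)
  have "word_length g (int (Suc m) * x) \<le> word_length g x + word_length g (int m * x)"
    using word_length_triangle[of g x "int m * x"] by (simp add: algebra_simps)
  with Suc show ?case by simp
qed simp

lemma word_dist_triangle: "word_dist g x z \<le> word_dist g x y + word_dist g y z"
  by (rule Metric_space.triangle[OF Metric_space_word_dist]) auto

lemma word_dist_commute: "word_dist g x y = word_dist g y x"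
  by (rule Metric_space.commute[OF Metric_space_word_dist])

lemma word_dist_of_nat_mult_le: "word_dist g (int m * x) (int m * y) \<le> m * word_dist g x y"
  using word_length_of_nat_mult_le[of g m "x - y"]
  by (simp add: word_dist_def right_diff_distrib flip: of_nat_mult)

section \<open>Coarse maps between word metrics\<close>

text \<open>Points of the Cayley graph are joined by geodesics of unit steps, so the bound for
  distance at most 1 adds up along such a path.\<close>

lemma controlled_word_dist_Lipschitz:
  assumes "controlled (word_dist g) (word_dist g') f"
  obtains L where "L \<ge> 0" "\<And>x y. word_dist g' (f x) (f y) \<le> L * word_dist g x y"
proof -
  from assms obtain L where "L \<ge> 0"
    and L: "\<And>x x'. word_dist g x x' \<le> 1 \<Longrightarrow> word_dist g' (f x) (f x') \<le> L"
    unfolding controlled_def by (meson zero_le_one)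
  have path: "word_dist g' (f (y + sum_list xs)) (f y) \<le> L * length xs"
    if "set xs \<subseteq> gens g" for xs y
    using that
  proof (induction xs arbitrary: y)
    case Nil
    then show ?case by (simp add: word_dist_def)
  next
    case (Cons s xs)
    have "word_dist g' (f (y + s)) (f y) \<le> L"
      using word_length_gen_le[of s g] Cons.prems by (intro L) (simp add: word_dist_def)
    moreover have "word_dist g' (f (y + s + sum_list xs)) (f (y + s)) \<le> L * length xs"
      using Cons by simp
    ultimately show ?case
      using word_dist_triangle[of g' "f (y + s + sum_list xs)" "f y" "f (y + s)"]
      by (simp add: algebra_simps)
  qed
  show ?thesis
  proof (rule that[OF \<open>L \<ge> 0\<close>])
    fix x y
    obtain xs where "length xs = word_length g (x - y)" "set xs \<subseteq> gens g" "sum_list xs = x - y"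
      by (rule word_length_attained)
    then show "word_dist g' (f x) (f y) \<le> L * word_dist g x y"
      using path[of xs y] by (simp add: word_dist_def)
  qed
qed

text \<open>Each added copy of \<open>x\<close> costs one \<open>C\<close>; the extra
  \<open>C\<close> pays for \<open>f 0\<close>, which may be nonzero.\<close>

lemma quasi_additive_of_nat_mult:
  assumes "\<And>a b. word_dist g (f (a + b)) (f a + f b) \<le> C"
  shows "word_dist g (f (int m * x)) (int m * f x) \<le> (real m + 1) * C"
proof (induction m)
  case 0
  show ?case
    using assms[of 0 0] word_length_uminus[of g "f 0"] by (simp add: word_dist_def)
next
  case (Suc m)
  have "word_dist g (f (x + int m * x)) (f x + int m * f x)
      \<le> C + word_dist g (f x + f (int m * x)) (f x + int m * f x)"
    using word_dist_triangle assms by (smt (verit))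
  also have "\<dots> \<le> C + (real m + 1) * C"
    using Suc by (simp add: word_dist_translate)
  finally show ?case by (simp add: algebra_simps)
qed

text \<open>With \<open>h\<close> a coarse inverse of \<open>f\<close>, \<open>p ^ k * y\<close> is
  near \<open>p ^ k * f (h y)\<close>, hence near \<open>f (p ^ k * h y)\<close>. The errors depend
  on \<open>k\<close> only, and \<open>A\<close> is the product of the Lipschitz constants of
  \<open>f\<close> and \<open>h\<close>.\<close>

lemma word_length_power_mult_bound_of_coarsely_isomorphic:
  assumes "coarsely_isomorphic (word_dist (int p)) (word_dist g)"
  obtains A :: real where
    "\<And>k. \<exists>B. \<forall>y. word_length g (int p ^ k * y) \<le> A * word_length g y + B"
proof -
  obtain f h C D where f: "controlled (word_dist p) (word_dist g) f"
    and h: "controlled (word_dist g) (word_dist p) h"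
    and C: "\<And>a b. word_dist g (f (a + b)) (f a + f b) \<le> C"
    and D: "\<And>y. word_dist g (f (h y)) y \<le> D"
    using assms unfolding coarsely_isomorphic_def coarse_equivalence_def close_functions_def
      bdd_above_def by (auto simp: comp_def)
  obtain L where L: "L \<ge> 0" "\<And>x y. word_dist g (f x) (f y) \<le> L * word_dist p x y"
    using controlled_word_dist_Lipschitz[OF f] by blast
  obtain M where M: "M \<ge> 0" "\<And>x y. word_dist p (h x) (h y) \<le> M * word_dist g x y"
    using controlled_word_dist_Lipschitz[OF h] by blast
  show ?thesis
  proof (rule that, intro exI allI)
    fix k y
    define m where "m = p ^ k"
    have "word_dist p (int m * h y) 0 \<le> word_dist p (h y) 0"
      using word_length_power_mult_le[of p k "h y"] by (simp add: word_dist_def m_def)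
    also have "\<dots> \<le> M * word_dist g y 0 + word_dist p (h 0) 0"
      using word_dist_triangle M(2) by (smt (verit))
    finally have "L * word_dist p (int m * h y) 0 \<le> L * (M * word_dist g y 0 + word_dist p (h 0) 0)"
      using L(1) by (rule mult_left_mono)
    then have "word_dist g (f (int m * h y)) (f 0) \<le> L * (M * word_dist g y 0 + word_dist p (h 0) 0)"
      using L(2) order_trans by blast
    moreover have "word_dist g (int m * y) (int m * f (h y)) \<le> m * D"
      using word_dist_of_nat_mult_le[of g m y "f (h y)"] mult_left_mono[OF D[of y], of "real m"]
      by (simp add: word_dist_commute)
    moreover have "word_dist g (int m * f (h y)) (f (int m * h y)) \<le> (real m + 1) * C"
      using quasi_additive_of_nat_mult[of g f C m "h y"] C by (simp add: word_dist_commute)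
    ultimately have "word_dist g (int m * y) 0
        \<le> m * D + (real m + 1) * C + L * (M * word_dist g y 0 + word_dist p (h 0) 0) + word_dist g (f 0) 0"
      using word_dist_triangle[of g "int m * y" 0 "int m * f (h y)"]
        word_dist_triangle[of g "int m * f (h y)" 0 "f (int m * h y)"]
        word_dist_triangle[of g "f (int m * h y)" 0 "f 0"]
      by linarith
    then show "word_length g (int p ^ k * y) \<le> L * M * word_length g y
        + (p ^ k * D + (p ^ k + 1) * C + L * word_dist p (h 0) 0 + word_dist g (f 0) 0)"
      by (simp add: word_dist_def m_def algebra_simps)
  qed
qed

section \<open>Balanced ternary digits\<close>

text \<open>\<open>(n + 1) div 3\<close> is the integer nearest to \<open>n / 3\<close>, so the
  digit split off is -1, 0 or 1.\<close>

function balanced_ternary_weight :: "int \<Rightarrow> nat" where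
  "balanced_ternary_weight n =
     (if n = 0 then 0 else balanced_ternary_weight ((n + 1) div 3) + (if 3 dvd n then 0 else 1))"
  by auto
termination
  by (relation "Wellfounded.measure (\<lambda>n. nat \<bar>n\<bar>)") auto

declare balanced_ternary_weight.simps [simp del]

lemma balanced_ternary_weight_0 [simp]: "balanced_ternary_weight 0 = 0"
  by (subst balanced_ternary_weight.simps) simp

lemma balanced_ternary_weight_digit:
  "balanced_ternary_weight (3 * a) = balanced_ternary_weight a"
  "balanced_ternary_weight (3 * a + 1) = Suc (balanced_ternary_weight a)"
  "balanced_ternary_weight (3 * a - 1) = Suc (balanced_ternary_weight a)"
proof -
  have "(3 * a + 1) div 3 = a" "(3 * a + 1 + 1) div 3 = a" "\<not> 3 dvd 3 * a + 1" "\<not> 3 dvd 3 * a - 1"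
    "3 * a + 1 \<noteq> 0" "3 * a - 1 \<noteq> 0"
    by presburger+
  then show
    "balanced_ternary_weight (3 * a) = balanced_ternary_weight a"
    "balanced_ternary_weight (3 * a + 1) = Suc (balanced_ternary_weight a)"
    "balanced_ternary_weight (3 * a - 1) = Suc (balanced_ternary_weight a)"
    by (subst balanced_ternary_weight.simps; simp)+
qed

lemma balanced_ternary_cases:
  obtains a :: int where "n = 3 * a" | a where "n = 3 * a + 1" | a where "n = 3 * a - 1"
proof -
  have "\<exists>a. n = 3 * a \<or> n = 3 * a + 1 \<or> n = 3 * a - 1" by presburger
  with that show ?thesis by blast
qed

text \<open>Digits -1 and 0 are incremented without a carry. A digit 1 becomes -1, still nonzero,
  and the carry is handled by induction.\<close>

lemma balanced_ternary_weight_add_1_le: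
  "balanced_ternary_weight (n + 1) \<le> Suc (balanced_ternary_weight n)"
proof (induction n rule: measure_induct_rule[of "\<lambda>n. nat \<bar>n\<bar>"])
  case (less n)
  show ?case
  proof (cases n rule: balanced_ternary_cases)
    case (2 a)
    have "balanced_ternary_weight (n + 1) = Suc (balanced_ternary_weight (a + 1))"
      using 2 balanced_ternary_weight_digit(3)[of "a + 1"] by (simp add: algebra_simps)
    also have "balanced_ternary_weight (a + 1) \<le> Suc (balanced_ternary_weight a)"
      using 2 balanced_ternary_weight_digit(2)[of 0] by (cases "a = 0") (auto intro!: less)
    finally show ?thesis using 2 by (simp add: balanced_ternary_weight_digit)
  qed (simp_all add: balanced_ternary_weight_digit)
qed

lemma balanced_ternary_weight_uminus [simp]:
  "balanced_ternary_weight (- n) = balanced_ternary_weight n"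
proof (induction n rule: measure_induct_rule[of "\<lambda>n. nat \<bar>n\<bar>"])
  case (less n)
  show ?case
  proof (cases n rule: balanced_ternary_cases)
    case (1 a)
    then show ?thesis
      using less[of a] balanced_ternary_weight_digit(1)[of a]
        balanced_ternary_weight_digit(1)[of "- a"] by (cases "a = 0") auto
  next
    case (2 a)
    then show ?thesis
      using less[of a] balanced_ternary_weight_digit(2)[of a]
        balanced_ternary_weight_digit(3)[of "- a"] by (cases "a = 0") auto
  next
    case (3 a)
    then show ?thesis
      using less[of a] balanced_ternary_weight_digit(3)[of a]
        balanced_ternary_weight_digit(2)[of "- a"] by (cases "a = 0") auto
  qed
qed

lemma balanced_ternary_weight_add_power_le:
  "balanced_ternary_weight (n + 3 ^ k) \<le> Suc (balanced_ternary_weight n)"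
proof (induction k arbitrary: n)
  case 0
  show ?case using balanced_ternary_weight_add_1_le by simp
next
  case (Suc k)
  show ?case
  proof (cases n rule: balanced_ternary_cases)
    case (1 a)
    then have *: "n + 3 ^ Suc k = 3 * (a + 3 ^ k)" by simp
    show ?thesis
      unfolding * balanced_ternary_weight_digit unfolding 1 balanced_ternary_weight_digit
      using Suc[of a] by simp
  next
    case (2 a)
    then have *: "n + 3 ^ Suc k = 3 * (a + 3 ^ k) + 1" by simp
    show ?thesis
      unfolding * balanced_ternary_weight_digit unfolding 2 balanced_ternary_weight_digit
      using Suc[of a] by simp
  next
    case (3 a)
    then have *: "n + 3 ^ Suc k = 3 * (a + 3 ^ k) - 1" by simp
    show ?thesis
      unfolding * balanced_ternary_weight_digit unfolding 3 balanced_ternary_weight_digit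
      using Suc[of a] by simp
  qed
qed

lemma balanced_ternary_weight_add_gen_le:
  assumes "s \<in> gens 3"
  shows "balanced_ternary_weight (s + n) \<le> Suc (balanced_ternary_weight n)"
proof -
  from assms obtain k where "s = 3 ^ k \<or> s = - (3 ^ k)"
    unfolding gens_def by blast
  then show ?thesis
  proof
    assume "s = - (3 ^ k)"
    then have "s + n = - (- n + 3 ^ k)" by simp
    then show ?thesis
      using balanced_ternary_weight_add_power_le[of "- n" k]
      by (metis balanced_ternary_weight_uminus)
  qed (use balanced_ternary_weight_add_power_le[of n k] in \<open>simp add: add.commute\<close>)
qed

lemma balanced_ternary_weight_le_word_length: "balanced_ternary_weight n \<le> word_length 3 n"
proof -
  have "balanced_ternary_weight (sum_list xs) \<le> length xs" if "set xs \<subseteq> gens 3" for xs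
    using that
  proof (induction xs)
    case (Cons s xs)
    then show ?case
      using balanced_ternary_weight_add_gen_le[of s "sum_list xs"] by simp
  qed simp
  then show ?thesis by (metis word_length_attained)
qed

text \<open>The bound says that \<open>u\<close> fits into the lowest \<open>m\<close> digits, so
  \<open>u\<close> and \<open>3 ^ m * v\<close> occupy disjoint positions.\<close>

lemma balanced_ternary_weight_add_shift:
  assumes "2 * \<bar>u\<bar> \<le> 3 ^ m"
  shows "balanced_ternary_weight (u + 3 ^ m * v) = balanced_ternary_weight u + balanced_ternary_weight v"
  using assms
proof (induction m arbitrary: u)
  case 0
  then have "u = 0" by simp
  then show ?case by simp
next
  case (Suc m)
  show ?case
  proof (cases u rule: balanced_ternary_cases)
    case (1 a)
    then have *: "u + 3 ^ Suc m * v = 3 * (a + 3 ^ m * v)" by simp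
    have "2 * \<bar>a\<bar> \<le> 3 ^ m" using 1 Suc.prems by simp
    then show ?thesis
      unfolding * balanced_ternary_weight_digit unfolding 1 balanced_ternary_weight_digit
      using Suc.IH[of a] by simp
  next
    case (2 a)
    then have *: "u + 3 ^ Suc m * v = 3 * (a + 3 ^ m * v) + 1" by simp
    \<comment> \<open>For negative \<open>a\<close> the premise only yields
      \<open>2 * \<bar>a\<bar>\<close> at most \<open>3 ^ m\<close> plus 2/3; integrality removes
      the excess.\<close>
    have "2 * \<bar>a\<bar> \<le> 3 ^ m" using 2 Suc.prems by (auto simp: abs_if split: if_splits)
    then show ?thesis
      unfolding * balanced_ternary_weight_digit unfolding 2 balanced_ternary_weight_digit
      using Suc.IH[of a] by simp
  next
    case (3 a)
    then have *: "u + 3 ^ Suc m * v = 3 * (a + 3 ^ m * v) - 1" by simp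
    have "2 * \<bar>a\<bar> \<le> 3 ^ m" using 3 Suc.prems by (auto simp: abs_if split: if_splits)
    then show ?thesis
      unfolding * balanced_ternary_weight_digit unfolding 3 balanced_ternary_weight_digit
      using Suc.IH[of a] by simp
  qed
qed

section \<open>Powers of two with many nonzero digits\<close>

text \<open>The lowest \<open>n\<close> digits of \<open>x\<close> are all 1: the lowest one must
  be, and \<open>x = 3 * a + 1\<close> gives \<open>2 * x + 1 = 3 * (2 * a + 1)\<close>, the same
  condition on \<open>a\<close> one power lower.\<close>

lemma balanced_ternary_weight_ge_if_dvd:
  assumes "3 ^ n dvd 2 * x + 1"
  shows "n \<le> balanced_ternary_weight x"
  using assms
proof (induction n arbitrary: x)
  case (Suc n)
  then have "3 dvd 2 * x + 1" by (meson dvd_power dvd_trans zero_less_Suc)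
  then have "\<exists>a. x = 3 * a + 1" by presburger
  then obtain a where a: "x = 3 * a + 1" ..
  then have "3 * 3 ^ n dvd 3 * (2 * a + 1)"
    using Suc.prems by (simp add: algebra_simps)
  then have "3 ^ n dvd 2 * a + 1"
    by (simp only: dvd_mult_cancel_left) simp
  then show ?case
    using Suc.IH[of a] a by (simp add: balanced_ternary_weight_digit)
qed simp

lemma three_power_dvd_two_power_plus_1: "(3::int) ^ Suc n dvd 2 ^ (3 ^ n) + 1"
proof (induction n)
  case (Suc n)
  define t :: int where "t = 2 ^ (3 ^ n)"
  have dvd: "3 ^ Suc n dvd t + 1" using Suc by (simp add: t_def)
  then have "3 dvd t + 1" by (meson dvd_power dvd_trans zero_less_Suc)
  \<comment> \<open>This is the cofactor of \<open>t + 1\<close> in \<open>t ^ 3 + 1\<close>, so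
    cubing \<open>t\<close> gains a factor 3.\<close>
  then have "3 dvd (t + 1) * (t + 1) - 3 * t" by simp
  then have "3 ^ Suc n * 3 dvd (t + 1) * ((t + 1) * (t + 1) - 3 * t)"
    using dvd by (rule mult_dvd_mono[rotated])
  also have "\<dots> = t ^ 3 + 1"
    by (simp add: power3_eq_cube algebra_simps)
  also have "t ^ 3 = 2 ^ (3 ^ Suc n)"
    by (simp add: t_def mult.commute flip: power_mult)
  finally show ?case by (simp add: mult.commute)
qed simp

lemma exists_power_of_two_large_balanced_ternary_weight:
  "\<exists>k. n < balanced_ternary_weight (2 ^ k)"
proof -
  have "(2::int) * 2 ^ (3 ^ n - 1) = 2 ^ (3 ^ n)"
    by (simp flip: power_Suc)
  then show ?thesis
    using balanced_ternary_weight_ge_if_dvd[of "Suc n" "2 ^ (3 ^ n - 1)"]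
      three_power_dvd_two_power_plus_1[of n] by (auto simp: Suc_le_eq)
qed

section \<open>Separated digit blocks and the contradiction\<close>

lemma exists_word_length_le_balanced_ternary_weight_mult:
  "\<exists>y. word_length 3 y \<le> N \<and> balanced_ternary_weight (x * y) = N * balanced_ternary_weight x"
proof (induction N)
  case (Suc N)
  then obtain y where y: "word_length 3 y \<le> N"
    "balanced_ternary_weight (x * y) = N * balanced_ternary_weight x"
    by blast
  \<comment> \<open>A shift by \<open>m\<close> digits clears a copy of \<open>x\<close>, because
    \<open>m < 2 ^ m \<le> 3 ^ m\<close>. Then \<open>1 + 3 ^ m * y\<close> places one more copy
    below those in \<open>x * y\<close>.\<close>
  define m where "m = nat (2 * \<bar>x\<bar>)"
  have "int m < 3 ^ m"
    using of_nat_less_two_power[of m, where ?'a = int] power_mono[of 2 "3::int" m] by linarith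
  then have m: "2 * \<bar>x\<bar> \<le> 3 ^ m" by (simp add: m_def)
  have "word_length 3 (1 + 3 ^ m * y) \<le> 1 + word_length 3 y"
    using word_length_triangle[of 3 1 "3 ^ m * y"] word_length_power_mult_le[of 3 m y]
      word_length_gen_le[of 1 3] by (force simp: gens_def intro: exI[of _ "0::nat"])
  moreover have "balanced_ternary_weight (x * (1 + 3 ^ m * y)) = Suc N * balanced_ternary_weight x"
    using balanced_ternary_weight_add_shift[OF m, of "x * y"] y by (simp add: algebra_simps)
  ultimately show ?case using y(1) by (intro exI[of _ "1 + 3 ^ m * y"]) simp
qed (auto intro: exI[of _ 0])

theorem corollary3p11:
  shows "\<not> coarsely_isomorphic (word_dist 2) (word_dist 3)"
proof
  assume "coarsely_isomorphic (word_dist 2) (word_dist 3)"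
  then obtain A :: real
    where A: "\<And>k. \<exists>B. \<forall>y. word_length 3 (2 ^ k * y) \<le> A * word_length 3 y + B"
    using word_length_power_mult_bound_of_coarsely_isomorphic[of 2 3] by auto
  define n where "n = nat \<lceil>A\<rceil>"
  obtain k where k: "n < balanced_ternary_weight (2 ^ k)"
    using exists_power_of_two_large_balanced_ternary_weight by blast
  from A[of k] obtain B where B: "\<And>y. word_length 3 (2 ^ k * y) \<le> A * word_length 3 y + B"
    by blast
  \<comment> \<open>The estimates below combine to \<open>N * (n + 1) \<le> n * N + B\<close>, that
    is \<open>N \<le> B\<close>, which this choice excludes.\<close>
  define N where "N = Suc (nat \<lceil>B\<rceil>)"
  obtain y where y: "word_length 3 y \<le> N"
    "balanced_ternary_weight (2 ^ k * y) = N * balanced_ternary_weight (2 ^ k)"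
    using exists_word_length_le_balanced_ternary_weight_mult by blast
  have "N * (n + 1) \<le> N * balanced_ternary_weight (2 ^ k)"
    using k by (intro mult_left_mono) auto
  also have "\<dots> \<le> word_length 3 (2 ^ k * y)"
    using balanced_ternary_weight_le_word_length[of "2 ^ k * y"] y(2) by simp
  finally have "real (N * (n + 1)) \<le> A * word_length 3 y + B"
    using B[of y] by linarith
  also have "A * word_length 3 y \<le> real n * N"
    using y(1) by (intro mult_mono) (auto simp: n_def real_nat_ceiling_ge)
  finally have "real N \<le> B" by (simp add: algebra_simps)
  moreover have "B < real N" unfolding N_def using real_nat_ceiling_ge[of B] by simp
  ultimately show False by simp
qed

end
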